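(* Let $\varpi$ be a relativity groupoid and $\mathrm{Obs}(\varpi)$ its algebra of observers over the commutative ring $\mathcal{F}$, with trace $\mathrm{tr}$ and finite constant $c$, as specified in the context. For objects $p,q,r$ of $\varpi$ set $\mathbf{u}\equiv\varpi(p,q)$ (so that the source of $\mathbf{u}$ is $p$) and $\mathbf{v}\equiv\varpi(q,r)$, and write composition of morphisms from right to left, so that $$\varpi(q,r)\circ\varpi(p,q)=\varpi(p,r)=\mathbf{v}\circ\mathbf{u}.$$ Then the binary composition $\circ$ of composable arrows is associative, and it has the following explicit $p$-dependent form in $\mathrm{Obs}(\varpi)$: $$\left(1-\frac{\mathbf{v}\cdot\mathbf{u}^{-1}}{c^2}\right)(\mathbf{v}\circ\mathbf{u})=\mathbf{u}+\left(1-\frac{\mathbf{u}^2}{c^2}\right)\mathbf{v}\,p+\frac{1}{c}\,(\mathbf{v}\cdot\mathbf{u}^{-1})\,p .$$ Here $\mathbf{u}^{-1}=\varpi(q,p)$ is the groupoid inverse of $\mathbf{u}$, $\mathbf{v}\,p$ is the product in $\mathrm{Obs}(\varpi)$ of the arrow $\mathbf{v}$ with the object $p$, $\mathbf{v}\cdot\mathbf{u}^{-1}=\varpi(q,r)\cdot\varpi(q,p)$ is the scalar product of two arrows with common source $q$, and $\mathbf{u}^2=|\mathbf{u}|^2=\mathbf{u}\cdot\mathbf{u}$ is the scalar square (not the product of $\mathbf{u}$ with itself in $\mathrm{Obs}(\varpi)$).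
   Context: **Relativity groupoid.** A relativity groupoid $\varpi$ is a pair groupoid, i.e. a groupoid category such that for every ordered pair of objects $(p,q)$ there is exactly one arrow from $p$ to $q$. Objects are called massive bodies (observers). The unique arrow with source $p$ and target $q$ is denoted $\varpi(p,q)$ and is called the binary velocity of $q$ relative to $p$. Composition is written from right to left. The identity arrow at $p$ is $\varpi(p,p)=\mathbf{0}_p$, and the inverse of $\varpi(p,q)$ for $\circ$ is $\varpi(q,p)$. **Algebra of observers.** Let $\mathcal{F}$ be an associative, unital, commutative ring (thought of as a ring of real-valued classical measurements), and let $\mathrm{span}_{\mathcal F}\,\varpi$ be the $\mathcal{F}$-module of formal $\mathcal{F}$-linear combinations of objects and arrows of $\varpi$. All identity arrows $\varpi(p,p)$ are equal to the zero element of this algebra, although as arrows of $\varpi$ they are not identified with each other. It is postulated that this module carries an associative $\mathcal{F}$-algebra structure, denoted $\mathrm{Obs}(\varpi)$ (product written by juxtaposition), together with a distinguished $\mathcal{F}$-linear map $\mathrm{tr}:\mathrm{Obs}(\varpi)\to\mathcal{F}$ and a finite nonzero constant $c$ (light speed, an invertible scalar), such that: 1. Every object $p$ is an idempotent, $p^2=p$, and $\mathrm{tr}\,p=1$. 2. For all objects $p,q$, the arrow $\varpi(p,q)$ is the element of $\mathrm{Obs}(\varpi)$ given by $$\frac{\varpi(p,q)}{c}=\frac{qp}{\mathrm{tr}(qp)}-p .$$ 3. For every non-empty word of objects $p,q,r,\ldots,s$, $$1\le\{\mathrm{tr}(pqr\cdots s)\}^2=\mathrm{tr}(pq)\,\mathrm{tr}(qr)\cdots\mathrm{tr}(sp),$$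 where the right-hand side is the product of the traces of all cyclically consecutive pairs of letters in the word. 4. For all objects $p,q,r$: $1\le\mathrm{tr}(pq)=\mathrm{tr}(qp)$ and $\mathrm{tr}(pqr)=\mathrm{tr}(qpr)$. 5. For all objects $p,q$ and every $A\in\mathrm{Obs}(\varpi)$, $$qAp=\mathrm{tr}(qAp)\left\{p+\frac1c\,\varpi(p,q)\right\}.$$ The traces of words of objects are invertible elements of $\mathcal{F}$, so that the divisions written here make sense. **Scalar product of arrows.** For two arrows with the same source $q$, their scalar product in $\mathcal{F}$ is defined by $$\frac{\varpi(q,p)\cdot\varpi(q,r)}{c^2}\equiv 1-\frac{\mathrm{tr}(pr)}{\mathrm{tr}(pqr)},$$ so that in particular the scalar magnitude of an arrow satisfies $$\left(\frac{|\varpi(p,q)|}{c}\right)^2=1-\frac{1}{\mathrm{tr}(pq)}.$$ *)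

theory Defs
  imports Complex_Main
begin

text \<open>
  Associativity of composition is deliberately not among the axioms below: uniqueness of arrows
  forces it, and it is one of the claims of the theorem. The composition
  \<open>g \<odot> f\<close> is read from right to left and is constrained only when \<open>src g = tgt f\<close>.
\<close>

locale relativity_groupoid =
  fixes src tgt :: "'a \<Rightarrow> 'o"
    and compose :: "'a \<Rightarrow> 'a \<Rightarrow> 'a" (infixl "\<odot>" 70)
    and ident :: "'o \<Rightarrow> 'a"
    and ginv :: "'a \<Rightarrow> 'a"
    and \<omega> :: "'o \<Rightarrow> 'o \<Rightarrow> 'a"
  assumes src_compose: "src g = tgt f \<Longrightarrow> src (g \<odot> f) = src f"
    and tgt_compose: "src g = tgt f \<Longrightarrow> tgt (g \<odot> f) = tgt g"
    and src_ident: "src (ident p) = p"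
    and tgt_ident: "tgt (ident p) = p"
    and compose_ident_right: "f \<odot> ident (src f) = f"
    and compose_ident_left: "ident (tgt f) \<odot> f = f"
    and src_ginv: "src (ginv f) = tgt f"
    and tgt_ginv: "tgt (ginv f) = src f"
    and ginv_left: "ginv f \<odot> f = ident (src f)"
    and ginv_right: "f \<odot> ginv f = ident (tgt f)"
    and unique_arrow: "src f = p \<and> tgt f = q \<longleftrightarrow> f = \<omega> p q"

text \<open>Inverse of a unit of a commutative ring; unspecified on non-units.\<close>

definition recip :: "'f::comm_ring_1 \<Rightarrow> 'f" where
  "recip x = (THE y. x * y = 1)"

text \<open>
  \<open>obj_word obj p [q, \<dots>, s]\<close> is the product \<open>p q \<dots> s\<close>. Words are non-empty
  and start with a distinguished letter, because the algebra need not have a unit.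
\<close>

definition obj_word :: "('o \<Rightarrow> 'm::ring) \<Rightarrow> 'o \<Rightarrow> 'o list \<Rightarrow> 'm" where
  "obj_word obj p ps = foldl (\<lambda>x q. x * obj q) (obj p) ps"

text \<open>
  The product \<open>tr(pq) tr(qr) \<dots> tr(sp)\<close> over cyclically consecutive letters; for the
  one-letter word it is \<open>tr(pp)\<close>.
\<close>

definition cyclic_trace_prod ::
    "('m::ring \<Rightarrow> 'f::comm_ring_1) \<Rightarrow> ('o \<Rightarrow> 'm) \<Rightarrow> 'o \<Rightarrow> 'o list \<Rightarrow> 'f" where
  "cyclic_trace_prod tr obj p ps =
     prod_list (map (\<lambda>(x, y). tr (obj x * obj y)) (zip (p # ps) (ps @ [p])))"

text \<open>
  The type \<open>'m\<close> is \<open>Obs(\<omega>)\<close>; its class \<open>ring\<close> supplies the associative, not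
  necessarily unital, product. The maps \<open>obj\<close> and \<open>arr\<close> send objects and arrows to the
  corresponding elements. The axioms \<open>generators_inj\<close>, \<open>generators_independent\<close> and
  \<open>generators_span\<close> say that the module is that of formal linear combinations of objects and
  arrows modulo the identity arrows, i.e. free on the objects and the non-identity arrows.
\<close>

locale observer_algebra =
  relativity_groupoid src tgt compose ident ginv \<omega> + module scale
  for src tgt :: "'a \<Rightarrow> 'o"
    and compose :: "'a \<Rightarrow> 'a \<Rightarrow> 'a"
    and ident :: "'o \<Rightarrow> 'a"
    and ginv :: "'a \<Rightarrow> 'a"
    and \<omega> :: "'o \<Rightarrow> 'o \<Rightarrow> 'a"
    and scale :: "'f::{comm_ring_1,ordered_comm_ring} \<Rightarrow> 'm::ring \<Rightarrow> 'm" (infixr "*s" 75) +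
  fixes obj :: "'o \<Rightarrow> 'm"
    and arr :: "'a \<Rightarrow> 'm"
    and tr :: "'m \<Rightarrow> 'f"
    and c :: 'f
  assumes scale_mult_left: "(a *s x) * y = a *s (x * y)"
    and scale_mult_right: "x * (a *s y) = a *s (x * y)"
    and arr_ident: "arr (ident p) = 0"
    and generators_inj: "inj_on (case_sum obj arr) (range Inl \<union> Inr ` (- range ident))"
    and generators_independent: "independent (range obj \<union> arr ` (- range ident))"
    and generators_span: "span (range obj \<union> arr ` (- range ident)) = UNIV"
    and tr_linear: "module_hom (*s) (*) tr"
    and c_unit: "c dvd 1"
    and tr_word_unit: "tr (obj_word obj p ps) dvd 1"
    and obj_idem: "obj p * obj p = obj p"
    and tr_obj: "tr (obj p) = 1"
    and arr_eq: "recip c *s arr (\<omega> p q) = recip (tr (obj q * obj p)) *s (obj q * obj p) - obj p"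
    and tr_word_ge: "1 \<le> (tr (obj_word obj p ps))\<^sup>2"
    and tr_word_sq: "(tr (obj_word obj p ps))\<^sup>2 = cyclic_trace_prod tr obj p ps"
    and tr_pair_ge: "1 \<le> tr (obj p * obj q)"
    and tr_pair_commute: "tr (obj p * obj q) = tr (obj q * obj p)"
    and tr_triple_commute: "tr (obj p * obj q * obj r) = tr (obj q * obj p * obj r)"
    and sandwich: "obj q * A * obj p
                     = tr (obj q * A * obj p) *s (obj p + recip c *s arr (\<omega> p q))"

text \<open>
  Scalar product of two arrows with the same source; meaningful only if \<open>src f = src g\<close>.
  With \<open>f = \<omega> q p\<close> and \<open>g = \<omega> q r\<close> it is \<open>c\<^sup>2 (1 - tr(pr) / tr(pqr))\<close>.
\<close>

definition arrow_dot ::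
    "('a \<Rightarrow> 'o) \<Rightarrow> ('a \<Rightarrow> 'o) \<Rightarrow> ('o \<Rightarrow> 'm::ring) \<Rightarrow> ('m \<Rightarrow> 'f::comm_ring_1) \<Rightarrow> 'f \<Rightarrow> 'a \<Rightarrow> 'a \<Rightarrow> 'f" where
  "arrow_dot src tgt obj tr c f g =
     c\<^sup>2 * (1 - tr (obj (tgt f) * obj (tgt g))
                * recip (tr (obj (tgt f) * obj (src f) * obj (tgt g))))"

end

theory Submission
  imports Defs
begin

text \<open>
  Multiplying axiom 2 by \<open>c\<close> expresses both sides of the composition law in terms of the products
  \<open>r p\<close>, \<open>q p\<close>, \<open>r q p\<close> and the object \<open>p\<close>. The scalar coefficients are \<open>tr(rp) / tr(rqp)\<close> on the
  left and \<open>1 / tr(pq)\<close> on the right, so \<open>q p\<close> cancels and the coefficients of \<open>p\<close> agree. The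
  sandwich axiom turns \<open>r q p\<close> into \<open>(tr(rqp) / tr(rp)) r p\<close>, and what remains is
  \<open>tr(rqp)\<^sup>2 = tr(rq) tr(qp) tr(pr)\<close>.
\<close>

text \<open>Inverses in a commutative ring are unique, so for a unit the definite description in
  \<open>recip\<close> picks out the actual inverse.\<close>

lemma mult_recip:
  assumes "x dvd (1::'f::comm_ring_1)"
  shows "x * recip x = 1"
proof -
  obtain y where y: "x * y = 1"
    using assms by (metis dvdE)
  have "z = y" if "x * z = 1" for z
    using y that by (metis mult.assoc mult.commute mult.right_neutral)
  with y show ?thesis
    unfolding recip_def by (metis (mono_tags, lifting) theI)
qed

lemma recip_eqI:
  assumes "x * y = (1::'f::comm_ring_1)"
  shows "recip x = y"
proof -
  have "x * recip x = 1"
    using assms by (metis dvd_triv_left mult_recip)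
  with assms show ?thesis
    by (metis mult.assoc mult.commute mult.right_neutral)
qed

context relativity_groupoid
begin

lemma src_arrow [simp]: "src (\<omega> p q) = p"
  and tgt_arrow [simp]: "tgt (\<omega> p q) = q"
  using unique_arrow by blast+

text \<open>An arrow is determined by its endpoints, so every equation between arrows, associativity
  included, reduces to comparing sources and targets.\<close>

lemma arrow_eqI: "src f = src g \<Longrightarrow> tgt f = tgt g \<Longrightarrow> f = g"
  by (metis unique_arrow)

lemma ginv_arrow [simp]: "ginv (\<omega> p q) = \<omega> q p"
  by (simp add: arrow_eqI src_ginv tgt_ginv)

lemma compose_arrow [simp]: "compose (\<omega> q r) (\<omega> p q) = \<omega> p r"
  by (simp add: arrow_eqI src_compose tgt_compose)

lemma compose_assoc:
  assumes "src g = tgt f" "src h = tgt g"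
  shows "compose (compose h g) f = compose h (compose g f)"
  by (rule arrow_eqI) (simp_all add: assms src_compose tgt_compose)

end

context observer_algebra
begin

lemma tr_pair_unit: "tr (obj p * obj q) dvd 1"
  using tr_word_unit [of p "[q]"] by (simp add: obj_word_def)

lemma tr_triple_unit: "tr (obj p * obj q * obj r) dvd 1"
  using tr_word_unit [of p "[q, r]"] by (simp add: obj_word_def)

lemma tr_triple_sq:
  "(tr (obj p * obj q * obj r))\<^sup>2
     = tr (obj p * obj q) * tr (obj q * obj r) * tr (obj r * obj p)"
  using tr_word_sq [of p "[q, r]"]
  by (simp add: obj_word_def cyclic_trace_prod_def mult.assoc)

lemma arr_arrow:
  "arr (\<omega> p q)
     = (c * recip (tr (obj q * obj p))) *s (obj q * obj p) - c *s obj p"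
proof -
  have "arr (\<omega> p q) = c *s recip c *s arr (\<omega> p q)"
    by (simp add: mult_recip c_unit)
  then show ?thesis
    by (simp add: arr_eq scale_right_diff_distrib)
qed

text \<open>Take the middle element in \<open>sandwich\<close> to be \<open>obj q\<close>; by
  \<open>arr_eq\<close> the bracket \<open>obj p + recip c *s arr (\<omega> p r)\<close> is the
  product \<open>obj r * obj p\<close> divided by its trace.\<close>

lemma triple_eq_scale_pair:
  "obj r * obj q * obj p
     = (tr (obj r * obj q * obj p) * recip (tr (obj r * obj p))) *s (obj r * obj p)"
  by (subst sandwich) (simp add: arr_eq)

lemma one_minus_dot:
  "1 - arrow_dot src tgt obj tr c (\<omega> q r) (\<omega> q p) * recip (c\<^sup>2)
     = tr (obj r * obj p) * recip (tr (obj r * obj q * obj p))"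
proof -
  have "c\<^sup>2 * recip (c\<^sup>2) = 1"
    using dvd_power_same [OF c_unit, of 2] by (simp add: mult_recip)
  then have "c\<^sup>2 * x * recip (c\<^sup>2) = x" for x
    by (metis mult.assoc mult.commute mult.right_neutral)
  then show ?thesis
    by (simp add: arrow_dot_def)
qed

lemma one_minus_dot_self:
  "1 - arrow_dot src tgt obj tr c (\<omega> p q) (\<omega> p q) * recip (c\<^sup>2)
     = recip (tr (obj q * obj p))"
proof -
  \<comment> \<open>Swapping the first two letters under the trace brings the two copies of
    \<open>obj q\<close> together, where idempotence merges them.\<close>
  have "tr (obj q * obj p * obj q) = tr (obj p * (obj q * obj q))"
    using tr_triple_commute [of q p q] by (simp add: mult.assoc)
  then have "tr (obj q * obj p * obj q) = tr (obj q * obj p)"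
    by (simp add: obj_idem tr_pair_commute)
  then show ?thesis
    by (simp add: one_minus_dot obj_idem tr_obj)
qed

text \<open>The inverse and the composite are already evaluated as \<open>\<omega> q p\<close> and
  \<open>\<omega> p r\<close>, so only algebra with traces and products of objects remains.\<close>

lemma composition_law:
  fixes p q r
  defines "dot \<equiv> arrow_dot src tgt obj tr c"
  shows "(1 - dot (\<omega> q r) (\<omega> q p) * recip (c\<^sup>2)) *s arr (\<omega> p r)
     = arr (\<omega> p q) + (1 - dot (\<omega> p q) (\<omega> p q) * recip (c\<^sup>2)) *s (arr (\<omega> q r) * obj p)
         + (recip c * dot (\<omega> q r) (\<omega> q p)) *s obj p"
proof -
  define T where "T = tr (obj r * obj q * obj p)"
  define a where "a = tr (obj r * obj p)"
  define b where "b = tr (obj q * obj p)"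
  define d where "d = tr (obj r * obj q)"
  have units: "T * recip T = 1" "a * recip a = 1" "b * recip b = 1" "d * recip d = 1"
      "c * recip c = 1"
    unfolding T_def a_def b_def d_def
    by (simp_all add: mult_recip tr_pair_unit tr_triple_unit c_unit)
  have sq: "T * T = d * b * a"
    unfolding T_def a_def b_def d_def
    using tr_triple_sq [of r q p] by (simp add: power2_eq_square tr_pair_commute)
  \<comment> \<open>Since \<open>T * T = d * b * a\<close> with all three factors units, the inverse
    of \<open>T\<close> is \<open>T\<close> divided by \<open>d * b * a\<close>. This form is what
    matches the two coefficients of \<open>obj r * obj p\<close> below.\<close>
  have "T * (recip b * recip d * T * recip a) = (T * T) * (recip d * recip b * recip a)"
    by (simp add: mult_ac)
  also have "\<dots> = (d * recip d) * (b * recip b) * (a * recip a)"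
    unfolding sq by (simp only: mult_ac)
  also have "\<dots> = 1"
    by (simp add: units)
  finally have recip_T: "recip T = recip b * recip d * T * recip a"
    by (rule recip_eqI)
  have "recip c * dot (\<omega> q r) (\<omega> q p) = recip c * (c\<^sup>2 * (1 - a * recip T))"
    by (simp add: dot_def arrow_dot_def T_def a_def)
  also have "\<dots> = (c * recip c) * (c * (1 - a * recip T))"
    by (simp only: power2_eq_square mult_ac)
  also have "\<dots> = c - c * a * recip T"
    by (simp add: units right_diff_distrib mult.assoc)
  finally have coeff_p: "recip c * dot (\<omega> q r) (\<omega> q p) = c - c * a * recip T" .
  have "arr (\<omega> q r) * obj p
      = (c * recip d) *s (obj r * obj q * obj p) - c *s (obj q * obj p)"
    by (simp add: arr_arrow left_diff_distrib scale_mult_left d_def)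
  also have "obj r * obj q * obj p = (T * recip a) *s (obj r * obj p)"
    unfolding T_def a_def by (rule triple_eq_scale_pair)
  finally have vp: "arr (\<omega> q r) * obj p
      = (c * recip d * (T * recip a)) *s (obj r * obj p) - c *s (obj q * obj p)"
    by simp
  have coeff_rp: "recip b * (c * recip d * (T * recip a)) = c * recip T"
    by (simp add: recip_T mult_ac)
  have "(1 - dot (\<omega> q r) (\<omega> q p) * recip (c\<^sup>2)) *s arr (\<omega> p r)
      = (a * recip T) *s ((c * recip a) *s (obj r * obj p) - c *s obj p)"
    by (simp add: dot_def one_minus_dot arr_arrow T_def a_def)
  also have "\<dots> = (a * recip T * (c * recip a)) *s (obj r * obj p) - (c * a * recip T) *s obj p"
    by (simp add: scale_right_diff_distrib mult_ac)
  also have "a * recip T * (c * recip a) = (a * recip a) * (c * recip T)"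
    by (simp only: mult_ac)
  also have "\<dots> = c * recip T"
    by (simp add: units)
  \<comment> \<open>Adding and subtracting \<open>(c * recip b) *s (obj q * obj p)\<close> and
    \<open>c *s obj p\<close> splits the expression into the three summands of the right-hand
    side.\<close>
  also have "(c * recip T) *s (obj r * obj p) - (c * a * recip T) *s obj p
      = ((c * recip b) *s (obj q * obj p) - c *s obj p)
        + ((c * recip T) *s (obj r * obj p) - (c * recip b) *s (obj q * obj p))
        + (c - c * a * recip T) *s obj p"
    by (simp add: scale_left_diff_distrib)
  also have "(c * recip T) *s (obj r * obj p) - (c * recip b) *s (obj q * obj p)
      = recip b *s (arr (\<omega> q r) * obj p)"
    unfolding vp scale_right_diff_distrib scale_scale coeff_rp by (simp add: mult.commute)
  \<comment> \<open>Both occurrences of \<open>recip b\<close> are rewritten here, so the summand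
    that becomes \<open>arr (\<omega> p q)\<close> temporarily contains the scalar square.\<close>
  also have "recip b = 1 - dot (\<omega> p q) (\<omega> p q) * recip (c\<^sup>2)"
    by (simp add: dot_def one_minus_dot_self b_def)
  also have "(c * (1 - dot (\<omega> p q) (\<omega> p q) * recip (c\<^sup>2))) *s (obj q * obj p) - c *s obj p
      = arr (\<omega> p q)"
    by (simp add: dot_def one_minus_dot_self arr_arrow)
  finally show ?thesis
    by (simp only: coeff_p)
qed

end

theorem theorem7p1:
  fixes src tgt :: "'a \<Rightarrow> 'o"
    and compose :: "'a \<Rightarrow> 'a \<Rightarrow> 'a" (infixl "\<odot>" 70)
    and ident :: "'o \<Rightarrow> 'a"
    and ginv :: "'a \<Rightarrow> 'a"
    and \<omega> :: "'o \<Rightarrow> 'o \<Rightarrow> 'a"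
    and scale :: "'f::{comm_ring_1,ordered_comm_ring} \<Rightarrow> 'm::ring \<Rightarrow> 'm" (infixr "*s" 75)
    and obj :: "'o \<Rightarrow> 'm"
    and arr :: "'a \<Rightarrow> 'm"
    and tr :: "'m \<Rightarrow> 'f"
    and c :: 'f
  assumes "observer_algebra src tgt compose ident ginv \<omega> scale obj arr tr c"
  shows "(\<forall>f g h. src g = tgt f \<and> src h = tgt g \<longrightarrow> (h \<odot> g) \<odot> f = h \<odot> (g \<odot> f)) \<and>
    (\<forall>p q r. let u = \<omega> p q; v = \<omega> q r; dot = arrow_dot src tgt obj tr c in
       (1 - dot v (ginv u) * recip (c\<^sup>2)) *s arr (v \<odot> u)
         = arr u + (1 - dot u u * recip (c\<^sup>2)) *s (arr v * obj p)
             + (recip c * dot v (ginv u)) *s obj p)"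
proof -
  interpret observer_algebra src tgt compose ident ginv \<omega> scale obj arr tr c
    by (fact assms)
  show ?thesis
    unfolding Let_def ginv_arrow compose_arrow
    using compose_assoc composition_law by blast
qed

end
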